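(* For every positive integer $k$, there exist bipartite graphs $G$ and $H$ with bipartitions $(A_G,B_G)$ and $(A_H,B_H)$, respectively, such that $H$ is a bipartite correspondence-cover of $G$ with respect to some $L: A_G\to 2^{A_H},\ B_G\to 2^{B_H}$ and such that the following holds: the maximum degree of $H$ in part $A_H$ is $1$ and in part $B_H$ is $k^{k-1}$, $|L(v)| = k$ for all $v\in V(G)$, and $H$ does not admit an independent transversal with respect to $L$.
   Context: Graphs are simple and undirected. Let $G$ and $H$ be bipartite graphs with bipartitions $(A_G,B_G)$ and $(A_H,B_H)$. $H$ is a bipartite cover of $G$ with respect to a mapping $L:V(G)\to 2^{V(H)}$ if: (a) $L$ induces a partition of $V(H)$, i.e. the sets $L(v)$, $v\in V(G)$, are nonempty, pairwise disjoint and have union $V(H)$, and there are no edges of $H$ between $L(v)$ and $L(v')$ whenever $vv'\notin E(G)$; and (b) the sets $L(v)$, $v\in A_G$, partition $A_H$ and the sets $L(w)$, $w\in B_G$, partition $B_H$ (this is what is meant by writing $L: A_G\to 2^{A_H}, B_G\to 2^{B_H}$). It is a bipartite correspondence-cover if, in addition, for each edge $vv'\in E(G)$ the subgraph of $H$ between $L(v)$ and $L(v')$ is a matching (not necessarily perfect, possibly empty). An independent transversal of $H$ with respect to $L$ is an independent set of $H$ that contains exactly one vertex of each $L(v)$, $v\in V(G)$. The maximum degree of $H$ in part $A_H$ (resp. $B_H$) is the maximum over vertices in that part of their degree in $H$. *)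

theory Defs
  imports "Graph_Theory.Graph_Theory" "HOL-Library.Disjoint_Sets"
begin

text \<open>
  Finite simple undirected graphs are rendered by the locale \<^locale>\<open>pair_graph\<close>: each edge
  \<open>uv\<close> is the pair of arcs \<open>(u,v)\<close>, \<open>(v,u)\<close>, so the degree of a vertex is its out-degree.
\<close>

definition bipartition :: "'a pair_pre_digraph \<Rightarrow> 'a set \<Rightarrow> 'a set \<Rightarrow> bool" where
  "bipartition G A B \<longleftrightarrow>
     pverts G = A \<union> B \<and> A \<inter> B = {} \<and> parcs G \<subseteq> A \<times> B \<union> B \<times> A"

text \<open>
  The partition is indexed: distinct indices must have disjoint (hence distinct) classes, which
  \<open>partition_on S (L ` I)\<close> would not ensure.
\<close>

definition indexed_partition :: "('i \<Rightarrow> 'a set) \<Rightarrow> 'i set \<Rightarrow> 'a set \<Rightarrow> bool" where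
  "indexed_partition L I S \<longleftrightarrow>
     (\<forall>i\<in>I. L i \<noteq> {}) \<and> disjoint_family_on L I \<and> (\<Union>i\<in>I. L i) = S"

text \<open>For disjoint \<open>X\<close> and \<open>Y\<close>, each edge between them is listed once, oriented from \<open>X\<close> to \<open>Y\<close>.\<close>

definition edges_between :: "'a pair_pre_digraph \<Rightarrow> 'a set \<Rightarrow> 'a set \<Rightarrow> ('a \<times> 'a) set" where
  "edges_between H X Y = parcs H \<inter> X \<times> Y"

definition matching :: "('a \<times> 'a) set \<Rightarrow> bool" where
  "matching M \<longleftrightarrow>
     (\<forall>e\<in>M. \<forall>f\<in>M. e \<noteq> f \<longrightarrow> {fst e, snd e} \<inter> {fst f, snd f} = {})"

definition bipartite_cover ::
  "'a pair_pre_digraph \<Rightarrow> 'a set \<Rightarrow> 'a set \<Rightarrow> 'b pair_pre_digraph \<Rightarrow> 'b set \<Rightarrow> 'b set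
    \<Rightarrow> ('a \<Rightarrow> 'b set) \<Rightarrow> bool" where
  "bipartite_cover G A\<^sub>G B\<^sub>G H A\<^sub>H B\<^sub>H L \<longleftrightarrow>
     indexed_partition L (pverts G) (pverts H) \<and>
     (\<forall>v\<in>pverts G. \<forall>v'\<in>pverts G. (v, v') \<notin> parcs G \<longrightarrow> edges_between H (L v) (L v') = {}) \<and>
     indexed_partition L A\<^sub>G A\<^sub>H \<and>
     indexed_partition L B\<^sub>G B\<^sub>H"

definition bipartite_correspondence_cover ::
  "'a pair_pre_digraph \<Rightarrow> 'a set \<Rightarrow> 'a set \<Rightarrow> 'b pair_pre_digraph \<Rightarrow> 'b set \<Rightarrow> 'b set
    \<Rightarrow> ('a \<Rightarrow> 'b set) \<Rightarrow> bool" where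
  "bipartite_correspondence_cover G A\<^sub>G B\<^sub>G H A\<^sub>H B\<^sub>H L \<longleftrightarrow>
     bipartite_cover G A\<^sub>G B\<^sub>G H A\<^sub>H B\<^sub>H L \<and>
     (\<forall>(v, v')\<in>parcs G. matching (edges_between H (L v) (L v')))"

definition independent_set :: "'a pair_pre_digraph \<Rightarrow> 'a set \<Rightarrow> bool" where
  "independent_set H S \<longleftrightarrow> S \<subseteq> pverts H \<and> (\<forall>x\<in>S. \<forall>y\<in>S. (x, y) \<notin> parcs H)"

definition independent_transversal ::
  "'a pair_pre_digraph \<Rightarrow> 'b pair_pre_digraph \<Rightarrow> ('a \<Rightarrow> 'b set) \<Rightarrow> 'b set \<Rightarrow> bool" where
  "independent_transversal G H L S \<longleftrightarrow>
     independent_set H S \<and> (\<forall>v\<in>pverts G. \<exists>!x. x \<in> S \<and> x \<in> L v)"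

text \<open>Meaningful for finite nonempty \<open>S\<close> only; \<open>Max {}\<close> is unspecified.\<close>

definition max_degree_in :: "'a pair_pre_digraph \<Rightarrow> 'a set \<Rightarrow> nat" where
  "max_degree_in H S = Max ((\<lambda>v. out_degree (with_proj H) v) ` S)"

end

theory Submission
  imports Defs "HOL-Library.Nat_Bijection"
begin

text \<open>
  Give one side of the base graph \<open>k\<close> vertices \<open>0, \<dots>, k - 1\<close>, and the other side one vertex for
  each word of length \<open>k\<close> over the alphabet \<open>{..<k}\<close>; let the base graph be complete bipartite.
  Every list is a copy of \<open>{..<k}\<close>. A transversal picks one letter from the list of each position
  \<open>i\<close>, so it spells a word \<open>f\<close>. In the cover, the \<open>i\<close>-th element of the list of a word \<open>f\<close> has the
  single neighbour ``letter \<open>f i\<close> at position \<open>i\<close>''. Hence the list of the very word that is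
  spelled is blocked completely: each of its elements is adjacent to a chosen letter, and no
  independent transversal exists (\<open>no_transversal\<close>).

  There is exactly one edge between the list of a word and the list of a position, so the matching
  condition is trivial. The degree of the letter \<open>c\<close> at position \<open>i\<close> is the number of words with
  that letter at that position, and this is \<open>k ^ (k - 1)\<close> (\<open>card_words_with_letter\<close>).
\<close>

lemma out_degree_with_proj: "out_degree (with_proj H) v = card {w. (v, w) \<in> parcs H}"
proof -
  have "out_arcs (with_proj H) v = Pair v ` {w. (v, w) \<in> parcs H}"
    by (auto simp: out_arcs_def)
  then show ?thesis
    by (simp add: out_degree_def card_image inj_on_def)
qed

lemma max_degree_in_const:
  assumes "S \<noteq> {}" "\<And>v. v \<in> S \<Longrightarrow> card {w. (v, w) \<in> parcs H} = d"
  shows "max_degree_in H S = d"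
proof -
  have "(\<lambda>v. out_degree (with_proj H) v) ` S = {d}"
    using assms by (auto simp: out_degree_with_proj)
  then show ?thesis
    by (simp add: max_degree_in_def)
qed

abbreviation words :: "nat \<Rightarrow> (nat \<Rightarrow> nat) set" where
  "words k \<equiv> {..<k} \<rightarrow>\<^sub>E {..<k}"

text \<open>Fixing one letter leaves \<open>k - 1\<close> free ones.\<close>

lemma card_words_with_letter:
  assumes "i < k" "c < k"
  shows "card {f \<in> words k. f i = c} = k ^ (k - 1)"
proof -
  have "{f \<in> words k. f i = c} = (\<Pi>\<^sub>E j\<in>{..<k}. if j = i then {c} else {..<k})"
    using assms by (fastforce simp: PiE_iff split: if_splits)
  also have "card \<dots> = (\<Prod>j<k. if j = i then 1 else k)"
    by (auto simp: card_PiE intro!: prod.cong)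
  also have "\<dots> = (\<Prod>j\<in>{..<k} - {i}. k)"
    using assms by (subst prod.remove[of _ i]) (auto intro!: prod.cong)
  also have "\<dots> = k ^ (k - 1)"
    using assms by simp
  finally show ?thesis .
qed

text \<open>
  Since the vertices of the base graph are to be natural numbers, a set \<open>A\<close> of numbers stands for
  the words, with \<open>F a\<close> the word that is named by \<open>a\<close>; the positions are the numbers below \<open>k\<close>.
\<close>

locale named_words =
  fixes k :: nat and A :: "nat set" and F :: "nat \<Rightarrow> nat \<Rightarrow> nat"
  assumes k_pos: "k \<ge> 1"
    and names: "bij_betw F A (words k)"
    and names_no_position: "A \<inter> {..<k} = {}"
begin

definition base :: "nat pair_pre_digraph" where
  "base = \<lparr>pverts = A \<union> {..<k}, parcs = A \<times> {..<k} \<union> {..<k} \<times> A\<rparr>"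

text \<open>The number \<open>prod_encode (v, j)\<close> plays the part of the \<open>j\<close>-th element of the list of \<open>v\<close>.\<close>

definition L :: "nat \<Rightarrow> nat set" where
  "L v = (\<lambda>j. prod_encode (v, j)) ` {..<k}"

definition cover_edges :: "(nat \<times> nat) set" where
  "cover_edges = (\<lambda>(a, i). (prod_encode (a, i), prod_encode (i, F a i))) ` (A \<times> {..<k})"

definition cover :: "nat pair_pre_digraph" where
  "cover = \<lparr>pverts = \<Union> (L ` (A \<union> {..<k})), parcs = cover_edges \<union> cover_edges\<inverse>\<rparr>"

lemma letter_less: "a \<in> A \<Longrightarrow> i < k \<Longrightarrow> F a i < k"
  using names by (force simp: bij_betw_def)

lemma finite_A: "finite A"
  using bij_betw_finite[OF names] by (simp add: finite_PiE)

lemma A_nonempty: "A \<noteq> {}"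
proof
  assume "A = {}"
  then have "words k = {}"
    using names by (auto simp: bij_betw_def)
  then show False
    using k_pos by (auto simp: PiE_eq_empty_iff)
qed

lemma name_not_position [simp]: "a \<in> A \<Longrightarrow> \<not> a < k"
  using names_no_position by auto

lemma mem_L: "x \<in> L v \<longleftrightarrow> (\<exists>j<k. x = prod_encode (v, j))"
  by (auto simp: L_def)

lemma card_L: "card (L v) = k"
  by (simp add: L_def card_image inj_on_def)

lemma union_L_nonempty: "I \<noteq> {} \<Longrightarrow> \<Union> (L ` I) \<noteq> {}"
  using k_pos by (auto simp: L_def lessThan_empty_iff)

lemma mem_cover_edges:
  "(x, y) \<in> cover_edges \<longleftrightarrow>
     (\<exists>a\<in>A. \<exists>i<k. x = prod_encode (a, i) \<and> y = prod_encode (i, F a i))"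
  by (auto simp: cover_edges_def)

lemma cover_edges_subset: "cover_edges \<subseteq> \<Union> (L ` A) \<times> \<Union> (L ` {..<k})"
  by (fastforce simp: mem_L mem_cover_edges letter_less)

lemma sides_disjoint: "\<Union> (L ` A) \<inter> \<Union> (L ` {..<k}) = {}"
  by (auto simp: mem_L)

lemma pair_graph_base: "pair_graph base"
  using finite_A
  by unfold_locales (auto simp: base_def symmetric_def sym_def)

lemma bipartition_cover: "bipartition cover (\<Union> (L ` A)) (\<Union> (L ` {..<k}))"
  using cover_edges_subset sides_disjoint by (auto simp: bipartition_def cover_def)

lemma pair_graph_cover: "pair_graph cover"
proof unfold_locales
  fix e assume e: "e \<in> parcs cover"
  define X where "X = \<Union> (L ` A)"
  define Y where "Y = \<Union> (L ` {..<k})"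
  have "pverts cover = X \<union> Y" "X \<inter> Y = {}" "e \<in> X \<times> Y \<union> Y \<times> X"
    using e bipartition_cover unfolding bipartition_def X_def Y_def by blast+
  then show "fst e \<in> pverts cover" "snd e \<in> pverts cover" "fst e \<noteq> snd e"
    by auto
next
  show "finite (pverts cover)"
    by (auto simp: cover_def L_def finite_A)
  show "finite (parcs cover)"
    by (auto simp: cover_def cover_edges_def finite_A)
  show "symmetric cover"
    by (simp add: cover_def symmetric_def sym_Un_converse)
qed

lemma bipartition_base: "bipartition base A {..<k}"
  using names_no_position by (auto simp: bipartition_def base_def)

lemma indexed_partition_L: "indexed_partition L I (\<Union> (L ` I))"
  using k_pos by (auto simp: indexed_partition_def disjoint_family_on_def L_def lessThan_empty_iff)

text \<open>
  For a word and a position \<open>i\<close>, the only edge between the two lists starts at the \<open>i\<close>-th element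
  of the list of the word.
\<close>

lemma matching_cover:
  assumes "(v, w) \<in> parcs base"
  shows "matching (edges_between cover (L v) (L w))"
proof -
  have "\<exists>e. edges_between cover (L v) (L w) \<subseteq> {e}"
  proof (cases "v \<in> A")
    case True
    then have "w < k"
      using assms by (auto simp: base_def)
    with True have "edges_between cover (L v) (L w)
      \<subseteq> {(prod_encode (v, w), prod_encode (w, F v w))}"
      by (auto simp: edges_between_def cover_def mem_L mem_cover_edges)
    then show ?thesis ..
  next
    case False
    then have "v < k" "w \<in> A"
      using assms by (auto simp: base_def)
    then have "edges_between cover (L v) (L w)
      \<subseteq> {(prod_encode (v, F w v), prod_encode (w, v))}"
      by (auto simp: edges_between_def cover_def mem_L mem_cover_edges)
    then show ?thesis ..
  qed
  then show ?thesis
    unfolding matching_def by blast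
qed

lemma correspondence_cover:
  "bipartite_correspondence_cover base A {..<k} cover (\<Union> (L ` A)) (\<Union> (L ` {..<k})) L"
proof -
  have "edges_between cover (L v) (L w) = {}" if "(v, w) \<notin> parcs base" for v w
    using that by (auto simp: base_def edges_between_def cover_def mem_L mem_cover_edges)
  then show ?thesis
    using matching_cover indexed_partition_L[of "A \<union> {..<k}"]
      indexed_partition_L[of A] indexed_partition_L[of "{..<k}"]
    unfolding bipartite_correspondence_cover_def bipartite_cover_def
    by (auto simp: base_def cover_def simp del: UN_Un)
qed

lemma degree_word_side: "max_degree_in cover (\<Union> (L ` A)) = 1"
proof (rule max_degree_in_const)
  show "\<Union> (L ` A) \<noteq> {}"
    using union_L_nonempty A_nonempty by simp
next
  fix x assume "x \<in> \<Union> (L ` A)"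
  then obtain a i where ai: "a \<in> A" "i < k" "x = prod_encode (a, i)"
    by (auto simp: mem_L)
  then have "{y. (x, y) \<in> parcs cover} = {prod_encode (i, F a i)}"
    by (auto simp: cover_def mem_cover_edges)
  then show "card {y. (x, y) \<in> parcs cover} = 1"
    by simp
qed

lemma degree_position_side: "max_degree_in cover (\<Union> (L ` {..<k})) = k ^ (k - 1)"
proof (rule max_degree_in_const)
  show "\<Union> (L ` {..<k}) \<noteq> {}"
    using union_L_nonempty k_pos by (simp add: lessThan_empty_iff)
next
  fix x assume "x \<in> \<Union> (L ` {..<k})"
  then obtain i c where ic: "i < k" "c < k" "x = prod_encode (i, c)"
    by (auto simp: mem_L)
  then have "{y. (x, y) \<in> parcs cover} = (\<lambda>a. prod_encode (a, i)) ` {a \<in> A. F a i = c}"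
    by (auto simp: cover_def mem_cover_edges)
  then have "card {y. (x, y) \<in> parcs cover} = card {a \<in> A. F a i = c}"
    by (simp add: card_image inj_on_def)
  also have "\<dots> = card (F ` {a \<in> A. F a i = c})"
    using names by (subst card_image) (auto simp: bij_betw_def inj_on_def)
  also have "F ` {a \<in> A. F a i = c} = {f \<in> words k. f i = c}"
    using names by (auto simp: bij_betw_def)
  finally show "card {y. (x, y) \<in> parcs cover} = k ^ (k - 1)"
    using card_words_with_letter ic by simp
qed

text \<open>A transversal spells a word, and the list of that word offers no element to choose.\<close>

lemma no_transversal: "\<not> independent_transversal base cover L S"
proof
  assume S: "independent_transversal base cover L S"
  have pick: "\<exists>j<k. prod_encode (v, j) \<in> S" if "v \<in> A \<union> {..<k}" for v
    using S that unfolding independent_transversal_def base_def mem_L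
    by (metis pair_pre_digraph.select_convs(1))
  then obtain f where f: "\<And>i. i < k \<Longrightarrow> f i < k \<and> prod_encode (i, f i) \<in> S"
    by (metis UnI2 lessThan_iff)
  then have "restrict f {..<k} \<in> words k"
    by auto
  then obtain a where a: "a \<in> A" "F a = restrict f {..<k}"
    using names by (metis bij_betw_iff_bijections)
  then obtain j where j: "j < k" "prod_encode (a, j) \<in> S"
    using pick by blast
  then have "(prod_encode (a, j), prod_encode (j, f j)) \<in> parcs cover"
    using a by (auto simp: cover_def mem_cover_edges)
  then show False
    using S f j by (auto simp: independent_transversal_def independent_set_def)
qed

end

theorem proposition9:
  fixes k :: nat
  assumes "k \<ge> 1"
  shows "\<exists>(G :: nat pair_pre_digraph) (H :: nat pair_pre_digraph) A\<^sub>G B\<^sub>G A\<^sub>H B\<^sub>H (L :: nat \<Rightarrow> nat set).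
    pair_graph G \<and> bipartition G A\<^sub>G B\<^sub>G \<and>
    pair_graph H \<and> bipartition H A\<^sub>H B\<^sub>H \<and>
    bipartite_correspondence_cover G A\<^sub>G B\<^sub>G H A\<^sub>H B\<^sub>H L \<and>
    A\<^sub>H \<noteq> {} \<and> max_degree_in H A\<^sub>H = 1 \<and>
    B\<^sub>H \<noteq> {} \<and> max_degree_in H B\<^sub>H = k ^ (k - 1) \<and>
    (\<forall>v\<in>pverts G. card (L v) = k) \<and>
    (\<nexists>S. independent_transversal G H L S)"
proof -
  have "card {k..<k + k ^ k} = card (words k)"
    by (simp add: card_PiE)
  then obtain F where "bij_betw F {k..<k + k ^ k} (words k)"
    using finite_same_card_bij[of "{k..<k + k ^ k}" "words k"] by (auto simp: finite_PiE)
  moreover have "{k..<k + k ^ k} \<inter> {..<k} = {}"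
    by auto
  \<comment> \<open>The names are kept abstract from here on: for a concrete interval, the simplification rule
    \<open>name_not_position\<close> rewrites in circles with the order rules for numbers.\<close>
  ultimately obtain A where "bij_betw F A (words k)" "A \<inter> {..<k} = {}"
    by blast
  with assms interpret named_words k A F
    by unfold_locales
  show ?thesis
  proof (rule exI[of _ base], rule exI[of _ cover], rule exI[of _ "A"],
      rule exI[of _ "{..<k}"], rule exI[of _ "\<Union> (L ` A)"],
      rule exI[of _ "\<Union> (L ` {..<k})"], rule exI[of _ L], intro conjI)
    show "\<Union> (L ` A) \<noteq> {}"
      by (rule union_L_nonempty) (rule A_nonempty)
    show "\<Union> (L ` {..<k}) \<noteq> {}"
      by (rule union_L_nonempty) (use k_pos in \<open>simp add: lessThan_empty_iff\<close>)
    show "\<forall>v\<in>pverts base. card (L v) = k"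
      by (simp add: card_L)
    show "\<nexists>S. independent_transversal base cover L S"
      by (simp add: no_transversal)
  qed (fact pair_graph_base pair_graph_cover bipartition_base bipartition_cover
      correspondence_cover degree_word_side degree_position_side)+
qed

end
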